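(* Let $D$ be a loose multipartite tournament in which every partite set has at most two vertices. Then $C_{1,2}(D)$ is an interval graph.
   Context: All graphs and digraphs are finite and simple. For a digraph $D$, $d_D(x,y)$ is the length of a shortest directed path from $x$ to $y$. The $(1,2)$-step competition graph $C_{1,2}(D)$ is the graph on $V(D)$ in which distinct $u,v$ are adjacent iff there is a vertex $w\notin\{u,v\}$ with either $d_{D-v}(u,w)\le 1$ and $d_{D-u}(v,w)\le 2$, or $d_{D-u}(v,w)\le 1$ and $d_{D-v}(u,w)\le 2$. A multipartite tournament is an orientation of a complete $k$-partite graph for some $k\ge3$ (with nonempty partite sets). A set of vertices is $\{1,2\}$-competing if it is a clique in $C_{1,2}(D)$. A multipartite tournament is loose if some partite set is not $\{1,2\}$-competing. A graph is an interval graph if its vertices can be assigned real intervals so that two distinct vertices are adjacent iff their intervals intersect. *)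

theory Defs
  imports
    "HOL-Analysis.Analysis"
    "HOL-Library.Disjoint_Sets"
    "HOL-Library.Extended_Nat"
    "Graph_Theory.Pair_Digraph"
begin

text \<open>
  Undirected simple graphs are represented as symmetric loop-free digraphs
  (\<^locale>\<open>pair_graph\<close>).
\<close>

text \<open>The infimum of the empty set is \<^term>\<open>\<infinity> :: enat\<close>: no path from \<open>u\<close> to \<open>v\<close>.\<close>

definition digraph_dist :: "('a, 'b) pre_digraph \<Rightarrow> 'a \<Rightarrow> 'a \<Rightarrow> enat" where
  "digraph_dist G u v = (INF p \<in> {p. pre_digraph.apath G u p v}. enat (length p))"

definition step_competition_graph :: "'a pair_pre_digraph \<Rightarrow> 'a pair_pre_digraph" (\<open>C\<^sub>1\<^sub>,\<^sub>2\<close>) where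
  "C\<^sub>1\<^sub>,\<^sub>2 D =
    \<lparr> pverts = pverts D,
      parcs = {(u, v). u \<in> pverts D \<and> v \<in> pverts D \<and> u \<noteq> v \<and>
        (\<exists>w \<in> pverts D - {u, v}.
          (digraph_dist (pre_digraph.del_vert (with_proj D) v) u w \<le> 1 \<and>
           digraph_dist (pre_digraph.del_vert (with_proj D) u) v w \<le> 2) \<or>
          (digraph_dist (pre_digraph.del_vert (with_proj D) u) v w \<le> 1 \<and>
           digraph_dist (pre_digraph.del_vert (with_proj D) v) u w \<le> 2))} \<rparr>"

definition complete_multipartite_graph :: "'a set set \<Rightarrow> 'a pair_pre_digraph" where
  "complete_multipartite_graph P =
    \<lparr> pverts = \<Union>P,
      parcs = {(u, v). \<exists>A \<in> P. \<exists>B \<in> P. A \<noteq> B \<and> u \<in> A \<and> v \<in> B} \<rparr>"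

definition orientation_of :: "'a pair_pre_digraph \<Rightarrow> 'a pair_pre_digraph \<Rightarrow> bool" where
  "orientation_of D G \<longleftrightarrow>
    pverts D = pverts G \<and> parcs D \<union> (parcs D)\<inverse> = parcs G \<and> parcs D \<inter> (parcs D)\<inverse> = {}"

text \<open>\<open>P\<close> is the family of partite sets; \<^const>\<open>partition_on\<close> makes them nonempty.\<close>

definition multipartite_tournament :: "'a pair_pre_digraph \<Rightarrow> 'a set set \<Rightarrow> bool" where
  "multipartite_tournament D P \<longleftrightarrow>
    finite (pverts D) \<and> partition_on (pverts D) P \<and> card P \<ge> 3 \<and>
    orientation_of D (complete_multipartite_graph P)"

definition graph_clique :: "'a pair_pre_digraph \<Rightarrow> 'a set \<Rightarrow> bool" where
  "graph_clique G S \<longleftrightarrow>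
    S \<subseteq> pverts G \<and> (\<forall>u \<in> S. \<forall>v \<in> S. u \<noteq> v \<longrightarrow> (u, v) \<in> parcs G)"

definition competing12 :: "'a pair_pre_digraph \<Rightarrow> 'a set \<Rightarrow> bool" where
  "competing12 D S \<longleftrightarrow> graph_clique (C\<^sub>1\<^sub>,\<^sub>2 D) S"

definition loose_multipartite_tournament :: "'a pair_pre_digraph \<Rightarrow> 'a set set \<Rightarrow> bool" where
  "loose_multipartite_tournament D P \<longleftrightarrow>
    multipartite_tournament D P \<and> (\<exists>X \<in> P. \<not> competing12 D X)"

definition interval_graph :: "'a pair_pre_digraph \<Rightarrow> bool" where
  "interval_graph G \<longleftrightarrow>
    (\<exists>I :: 'a \<Rightarrow> real set.
      (\<forall>v \<in> pverts G. is_interval (I v) \<and> I v \<noteq> {}) \<and>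
      (\<forall>u \<in> pverts G. \<forall>v \<in> pverts G. u \<noteq> v \<longrightarrow>
        ((u, v) \<in> parcs G \<longleftrightarrow> I u \<inter> I v \<noteq> {})))"

lemma pair_graph_step_competition_graph:
  assumes "finite (pverts D)"
  shows "pair_graph (C\<^sub>1\<^sub>,\<^sub>2 D)"
proof -
  let ?G = "C\<^sub>1\<^sub>,\<^sub>2 D"
  have V: "pverts ?G = pverts D"
    by (simp add: step_competition_graph_def)
  have arc: "fst e \<in> pverts D" "snd e \<in> pverts D" "fst e \<noteq> snd e" if "e \<in> parcs ?G" for e
    using that by (simp_all add: step_competition_graph_def case_prod_beta)
  have "parcs ?G \<subseteq> pverts D \<times> pverts D"
    by (rule subsetI) (simp only: mem_Times_iff arc simp_thms)
  then have "finite (parcs ?G)"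
    by (rule finite_subset) (simp add: assms)
  moreover have "sym (parcs ?G)"
  proof (rule symI)
    fix u v assume "(u, v) \<in> parcs ?G"
    then show "(v, u) \<in> parcs ?G"
      unfolding step_competition_graph_def pair_pre_digraph.simps mem_Collect_eq case_prod_conv
      by (subst insert_commute) blast
  qed
  ultimately show ?thesis
    by unfold_locales (simp_all only: V arc assms symmetric_def with_proj_simps not_False_eq_True)
qed

lemma pair_digraph_multipartite_tournament:
  assumes "multipartite_tournament D P"
  shows "pair_digraph D"
proof -
  have fin: "finite (pverts D)" and "partition_on (pverts D) P"
    and ori: "orientation_of D (complete_multipartite_graph P)"
    using assms unfolding multipartite_tournament_def by simp_all
  then have P: "\<Union>P = pverts D" "disjoint P"
    by (simp_all add: partition_on_def)
  have sub: "parcs D \<subseteq> parcs (complete_multipartite_graph P)"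
    using ori unfolding orientation_of_def by (elim conjE) (rule subset_trans[OF Un_upper1 equalityD1])
  have arc: "fst e \<in> pverts D" "snd e \<in> pverts D" "fst e \<noteq> snd e" if "e \<in> parcs D" for e
  proof -
    have "e \<in> parcs (complete_multipartite_graph P)"
      using sub that by (rule subsetD)
    then obtain A B where AB: "A \<in> P" "B \<in> P" "A \<noteq> B" "fst e \<in> A" "snd e \<in> B"
      unfolding complete_multipartite_graph_def pair_pre_digraph.simps mem_Collect_eq case_prod_beta
      by blast
    show "fst e \<in> pverts D" "snd e \<in> pverts D"
      using UnionI[OF AB(1,4)] UnionI[OF AB(2,5)] by (simp_all only: P)
    show "fst e \<noteq> snd e"
      using disjointD[OF P(2) AB(1-3)] AB(4,5) unfolding disjoint_iff by auto
  qed
  have "parcs D \<subseteq> pverts D \<times> pverts D"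
    by (rule subsetI) (simp only: mem_Times_iff arc simp_thms)
  then have "finite (parcs D)"
    by (rule finite_subset) (simp add: fin)
  then show ?thesis
    by unfold_locales (simp_all only: arc fin not_False_eq_True)
qed

end

theory Submission
  imports Defs
begin

text \<open>
  Let \<open>{a, b}\<close> be a partite set that is not competing. Since \<open>a\<close> and \<open>b\<close> do not compete, no arc
  joins an out-neighbour of \<open>a\<close> to one of \<open>b\<close>, so either one of them, say \<open>a\<close>, is a sink, or their
  out-neighbourhoods are singletons \<open>{w}\<close> and \<open>{z}\<close> with \<open>{w, z}\<close> a partite set. In the first case
  all vertices other than \<open>a\<close> and \<open>b\<close> have \<open>a\<close> as a common out-neighbour, so they form a clique,
  and \<open>a\<close> is isolated. In the second case every vertex outside \<open>{a, b, w, z}\<close> is adjacent to all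
  others, and the graph induced on \<open>{a, b, w, z}\<close> is a subgraph of the path \<open>a, z, w, b\<close>.
\<close>

section \<open>Short directed distances and adjacency in
  \<open>C\<^sub>1\<^sub>,\<^sub>2\<close>\<close>

lemma digraph_dist_le_enat_iff:
  "digraph_dist G u v \<le> enat n \<longleftrightarrow> (\<exists>p. pre_digraph.apath G u p v \<and> length p \<le> n)"
proof
  let ?S = "(\<lambda>p. enat (length p)) ` {p. pre_digraph.apath G u p v}"
  assume le: "digraph_dist G u v \<le> enat n"
  have "?S \<noteq> {}"
  proof
    assume "?S = {}"
    then have "digraph_dist G u v = top"
      by (simp only: digraph_dist_def Inf_empty)
    with le show False by (simp add: top_enat_def)
  qed
  \<comment> \<open>The bound \<open>n\<close> is finite, which excludes the empty family of paths.
    A nonempty set of \<open>enat\<close> has a least element, so some path attains the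
    distance.\<close>
  then have "Inf ?S \<in> ?S"
    by (metis Inf_enat_def LeastI_ex ex_in_conv)
  with le show "\<exists>p. pre_digraph.apath G u p v \<and> length p \<le> n"
    unfolding digraph_dist_def by auto
next
  assume "\<exists>p. pre_digraph.apath G u p v \<and> length p \<le> n"
  then show "digraph_dist G u v \<le> enat n"
    unfolding digraph_dist_def by (auto intro: INF_lower2)
qed

context wf_digraph
begin

lemma digraph_dist_le_1_iff:
  assumes "u \<noteq> w"
  shows "digraph_dist G u w \<le> 1 \<longleftrightarrow> u \<rightarrow>\<^bsub>G\<^esub> w"
proof
  assume "digraph_dist G u w \<le> 1"
  then obtain p where p: "apath u p w" "length p \<le> 1"
    unfolding one_enat_def digraph_dist_le_enat_iff by blast
  with assms obtain e where "p = [e]"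
    by (cases p) (auto simp: apath_def awalk_simps)
  with p show "u \<rightarrow>\<^bsub>G\<^esub> w"
    by (auto simp: apath_def awalk_simps arcs_ends_def arc_to_ends_def)
next
  assume "u \<rightarrow>\<^bsub>G\<^esub> w"
  then obtain e where "e \<in> arcs G" "tail G e = u" "head G e = w"
    by (auto simp: arcs_ends_def arc_to_ends_def)
  then have "apath u [e] w"
    using assms by (auto simp: apath_def awalk_simps)
  then show "digraph_dist G u w \<le> 1"
    unfolding one_enat_def digraph_dist_le_enat_iff by (intro exI[of _ "[e]"]) simp
qed

lemma digraph_dist_le_2_iff:
  assumes "u \<noteq> w"
  shows "digraph_dist G u w \<le> 2 \<longleftrightarrow> u \<rightarrow>\<^bsub>G\<^esub> w \<or> (\<exists>x. u \<rightarrow>\<^bsub>G\<^esub> x \<and> x \<rightarrow>\<^bsub>G\<^esub> w)"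
proof
  assume "digraph_dist G u w \<le> 2"
  then obtain p where p: "apath u p w" "length p \<le> 2"
    unfolding numeral_eq_enat digraph_dist_le_enat_iff by blast
  with assms consider e where "p = [e]" | e f where "p = [e, f]"
    by (cases p; cases "tl p") (auto simp: apath_def awalk_simps)
  then show "u \<rightarrow>\<^bsub>G\<^esub> w \<or> (\<exists>x. u \<rightarrow>\<^bsub>G\<^esub> x \<and> x \<rightarrow>\<^bsub>G\<^esub> w)"
    using p by cases
      (auto simp: apath_def awalk_simps arcs_ends_def arc_to_ends_def image_iff)
next
  have 1: "digraph_dist G u w \<le> 2" if "u \<rightarrow>\<^bsub>G\<^esub> w"
  proof -
    have "digraph_dist G u w \<le> 1"
      using that assms by (simp add: digraph_dist_le_1_iff)
    also have "(1::enat) \<le> 2" by (simp add: one_enat_def numeral_eq_enat)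
    finally show ?thesis .
  qed
  assume "u \<rightarrow>\<^bsub>G\<^esub> w \<or> (\<exists>x. u \<rightarrow>\<^bsub>G\<^esub> x \<and> x \<rightarrow>\<^bsub>G\<^esub> w)"
  then show "digraph_dist G u w \<le> 2"
  proof (elim disjE exE conjE)
    fix x assume x: "u \<rightarrow>\<^bsub>G\<^esub> x" "x \<rightarrow>\<^bsub>G\<^esub> w"
    show ?thesis
    \<comment> \<open>A \<open>wf_digraph\<close> may have loops. If \<open>x\<close> is an
      endpoint, the walk through \<open>x\<close> repeats a vertex and is no \<open>apath\<close>,
      but then one of its two arcs already goes from \<open>u\<close> to \<open>w\<close>.\<close>
    proof (cases "x = u \<or> x = w")
      case False
      obtain e f where "e \<in> arcs G" "tail G e = u" "head G e = x"
        "f \<in> arcs G" "tail G f = x" "head G f = w"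
        using x by (auto simp: arcs_ends_def arc_to_ends_def)
      then have "apath u [e, f] w"
        using assms False by (auto simp: apath_def awalk_simps)
      then show ?thesis
        unfolding numeral_eq_enat digraph_dist_le_enat_iff by (intro exI[of _ "[e, f]"]) simp
    qed (use x 1 in auto)
  qed (rule 1)
qed

end

text \<open>Since \<open>u\<close>, \<open>v\<close>, \<open>w\<close> are distinct, deleting the
  competitor restricts only the inner vertex \<open>x\<close> of a path of length 2. That
  \<open>w\<close> is a vertex is implicit, because \<open>w\<close> is the head of an arc.\<close>

lemma (in pair_wf_digraph) step_competition_graph_arc_iff:
  "(u, v) \<in> parcs (C\<^sub>1\<^sub>,\<^sub>2 G) \<longleftrightarrow> u \<in> pverts G \<and> v \<in> pverts G \<and> u \<noteq> v \<and>
    (\<exists>w. w \<noteq> u \<and> w \<noteq> v \<and>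
      ((u, w) \<in> parcs G \<and> ((v, w) \<in> parcs G \<or> (\<exists>x. x \<noteq> u \<and> (v, x) \<in> parcs G \<and> (x, w) \<in> parcs G)) \<or>
       (v, w) \<in> parcs G \<and> ((u, w) \<in> parcs G \<or> (\<exists>x. x \<noteq> v \<and> (u, x) \<in> parcs G \<and> (x, w) \<in> parcs G))))"
proof -
  have wf: "wf_digraph (pre_digraph.del_vert (with_proj G) v)" for v
    by (rule wf_digraph_del_vert)
  have dom: "x \<rightarrow>\<^bsub>pre_digraph.del_vert (with_proj G) v\<^esub> y \<longleftrightarrow> (x, y) \<in> parcs G \<and> x \<noteq> v \<and> y \<noteq> v"
    for v x y
    by (force simp: arcs_ends_def arc_to_ends_def pre_digraph.del_vert_def)
  have d1: "digraph_dist (pre_digraph.del_vert (with_proj G) v) u w \<le> 1 \<longleftrightarrow> (u, w) \<in> parcs G"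
    if "u \<noteq> w" "u \<noteq> v" "w \<noteq> v" for u v w
    using that by (simp add: wf_digraph.digraph_dist_le_1_iff[OF wf] dom)
  have d2: "digraph_dist (pre_digraph.del_vert (with_proj G) v) u w \<le> 2 \<longleftrightarrow>
      (u, w) \<in> parcs G \<or> (\<exists>x. x \<noteq> v \<and> (u, x) \<in> parcs G \<and> (x, w) \<in> parcs G)"
    if "u \<noteq> w" "u \<noteq> v" "w \<noteq> v" for u v w
    using that by (auto simp: wf_digraph.digraph_dist_le_2_iff[OF wf] dom)
  have V: "(x, y) \<in> parcs G \<Longrightarrow> y \<in> pverts G" for x y
    using in_arcsD2 by blast
  show ?thesis
  proof (cases "u \<in> pverts G \<and> v \<in> pverts G \<and> u \<noteq> v")
    case True
    then show ?thesis
      by (simp add: step_competition_graph_def Bex_def d1 d2 cong: conj_cong) (use V in blast)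
  qed (auto simp: step_competition_graph_def)
qed

lemma (in pair_wf_digraph) step_competition_graph_commute:
  "(u, v) \<in> parcs (C\<^sub>1\<^sub>,\<^sub>2 G) \<longleftrightarrow> (v, u) \<in> parcs (C\<^sub>1\<^sub>,\<^sub>2 G)"
  unfolding step_competition_graph_arc_iff by blast

section \<open>Explicit interval representations\<close>

lemma interval_graphI:
  fixes l r :: "'a \<Rightarrow> real"
  assumes "\<And>v. v \<in> pverts G \<Longrightarrow> l v \<le> r v"
    and "\<And>u v. u \<in> pverts G \<Longrightarrow> v \<in> pverts G \<Longrightarrow> u \<noteq> v \<Longrightarrow>
      (u, v) \<in> parcs G \<longleftrightarrow> l u \<le> r v \<and> l v \<le> r u"
  shows "interval_graph G"
proof -
  have "{l u..r u} \<inter> {l v..r v} \<noteq> {} \<longleftrightarrow> l u \<le> r v \<and> l v \<le> r u"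
    if "u \<in> pverts G" "v \<in> pverts G" for u v
    using assms(1)[OF that(1)] assms(1)[OF that(2)] by auto
  then show ?thesis
    unfolding interval_graph_def
    using assms by (intro exI[of _ "\<lambda>v. {l v..r v}"]) (auto simp: is_interval_cc)
qed

lemma interval_graph_clique_plus_isolated_plus_vertex:
  assumes "\<And>u v. (u, v) \<in> parcs G \<longleftrightarrow> (v, u) \<in> parcs G"
    and "\<And>u. u \<in> pverts G \<Longrightarrow> (a, u) \<notin> parcs G"
    and "\<And>u v. u \<in> pverts G - {a, b} \<Longrightarrow> v \<in> pverts G - {a, b} \<Longrightarrow> u \<noteq> v \<Longrightarrow> (u, v) \<in> parcs G"
  shows "interval_graph G"
proof (rule interval_graphI)
  \<comment> \<open>The isolated \<open>a\<close> is the point 2 and \<open>b\<close> is the point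
    0. All other intervals contain 1, and they are stretched down to 0 exactly for the neighbours of
    \<open>b\<close>.\<close>
  let ?l = "\<lambda>v. if v = a then 2 else if v = b \<or> (b, v) \<in> parcs G then 0 else 1 :: real"
  let ?r = "\<lambda>v. if v = a then 2 else if v = b then 0 else 1 :: real"
  show "?l v \<le> ?r v" for v by auto
  show "(u, v) \<in> parcs G \<longleftrightarrow> ?l u \<le> ?r v \<and> ?l v \<le> ?r u"
    if "u \<in> pverts G" "v \<in> pverts G" "u \<noteq> v" for u v
    using that assms by auto
qed

lemma interval_graph_universal_plus_path_subgraph:
  assumes comm: "\<And>u v. (u, v) \<in> parcs G \<longleftrightarrow> (v, u) \<in> parcs G"
    and dist: "distinct [a, z, w, b]"
    and no: "(a, b) \<notin> parcs G" "(a, w) \<notin> parcs G" "(b, z) \<notin> parcs G"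
    and univ: "\<And>u v. u \<in> pverts G - {a, b, w, z} \<Longrightarrow> v \<in> pverts G \<Longrightarrow> u \<noteq> v \<Longrightarrow> (u, v) \<in> parcs G"
  shows "interval_graph G"
proof (rule interval_graphI)
  \<comment> \<open>The vertices \<open>a\<close>, \<open>z\<close>, \<open>w\<close>,
    \<open>b\<close> start at 0, 1, 2, 3. Each of the first three reaches the start of the next one
    exactly if the two are adjacent, and otherwise is a point. The defaults 0 and 3 give every
    remaining vertex the whole range.\<close>
  let ?l = "\<lambda>v. if v = z then 1 else if v = w then 2 else if v = b then 3 else 0 :: real"
  let ?r = "\<lambda>v. if v = a then (if (a, z) \<in> parcs G then 1 else 0)
    else if v = z then (if (z, w) \<in> parcs G then 2 else 1)
    else if v = w then (if (w, b) \<in> parcs G then 3 else 2) else 3 :: real"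
  show "?l v \<le> ?r v" for v using dist by auto
  show "(u, v) \<in> parcs G \<longleftrightarrow> ?l u \<le> ?r v \<and> ?l v \<le> ?r u"
    if V: "u \<in> pverts G" "v \<in> pverts G" "u \<noteq> v" for u v
  proof (cases "u \<in> {a, b, w, z} \<and> v \<in> {a, b, w, z}")
    case True
    have no': "(b, a) \<notin> parcs G" "(w, a) \<notin> parcs G" "(z, b) \<notin> parcs G"
      using no comm by blast+
    have c: "(z, a) \<in> parcs G \<longleftrightarrow> (a, z) \<in> parcs G" "(w, z) \<in> parcs G \<longleftrightarrow> (z, w) \<in> parcs G"
      "(b, w) \<in> parcs G \<longleftrightarrow> (w, b) \<in> parcs G"
      using comm by blast+
    have ne: "a \<noteq> z" "a \<noteq> w" "a \<noteq> b" "z \<noteq> w" "z \<noteq> b" "w \<noteq> b"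
      using dist by auto
    have "u = a \<or> u = b \<or> u = w \<or> u = z" "v = a \<or> v = b \<or> v = w \<or> v = z"
      using True by blast+
    then show ?thesis
      using V(3) by (elim disjE; hypsubst) (simp_all add: ne ne[symmetric] no no' c)
  next
    case False
    then have "(u, v) \<in> parcs G"
      using univ[of u v] univ[of v u] comm[of u v] V by blast
    with False V(3) show ?thesis by auto
  qed
qed

section \<open>Out-neighbourhoods of a non-competing pair\<close>

theorem theorem4p8:
  fixes D :: "'a pair_pre_digraph" and P :: "'a set set"
  assumes "loose_multipartite_tournament D P"
    and "\<forall>X \<in> P. card X \<le> 2"
  shows "interval_graph (C\<^sub>1\<^sub>,\<^sub>2 D)"
proof -
  let ?E = "parcs D" and ?C = "parcs (C\<^sub>1\<^sub>,\<^sub>2 D)"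
  have mt: "multipartite_tournament D P"
    using assms(1) by (simp add: loose_multipartite_tournament_def)
  interpret pair_digraph D
    using mt by (rule pair_digraph_multipartite_tournament)
  note C_iff = step_competition_graph_arc_iff
  have VC [simp]: "pverts (C\<^sub>1\<^sub>,\<^sub>2 D) = pverts D"
    by (simp add: step_competition_graph_def)
  have fin: "finite (pverts D)" and "partition_on (pverts D) P"
    and ori: "orientation_of D (complete_multipartite_graph P)"
    using mt unfolding multipartite_tournament_def by simp_all
  then have part: "\<Union>P = pverts D" "disjoint P"
    by (simp_all add: partition_on_def)
  have arc_iff: "(u, v) \<in> ?E \<or> (v, u) \<in> ?E \<longleftrightarrow> (\<exists>A \<in> P. \<exists>B \<in> P. A \<noteq> B \<and> u \<in> A \<and> v \<in> B)"
    for u v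
  proof -
    have "?E \<union> ?E\<inverse> = {(u, v). \<exists>A \<in> P. \<exists>B \<in> P. A \<noteq> B \<and> u \<in> A \<and> v \<in> B}"
      using ori
      unfolding orientation_of_def complete_multipartite_graph_def pair_pre_digraph.simps
      by (elim conjE)
    from arg_cong[OF this, of "\<lambda>S. (u, v) \<in> S"] show ?thesis
      unfolding Un_iff converse_iff mem_Collect_eq case_prod_conv .
  qed
  have anti: "(v, u) \<notin> ?E" if "(u, v) \<in> ?E" for u v
  proof -
    have "?E \<inter> ?E\<inverse> = {}"
      using ori unfolding orientation_of_def by (elim conjE)
    with that show ?thesis by auto
  qed
  have cover: "\<exists>A \<in> P. v \<in> A" if "v \<in> pverts D" for v
    using that unfolding part(1)[symmetric] by (rule UnionE) (rule bexI)
  have same: "v \<in> A" if "A \<in> P" "u \<in> A" "v \<in> pverts D" "(u, v) \<notin> ?E" "(v, u) \<notin> ?E" for u v A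
    using arc_iff[of u v] cover[OF that(3)] that by metis
  have no_arc: "(u, v) \<notin> ?E" if A: "A \<in> P" "u \<in> A" "v \<in> A" for u v A
  proof
    assume "(u, v) \<in> ?E"
    then obtain B C where "B \<in> P" "C \<in> P" "B \<noteq> C" "u \<in> B" "v \<in> C"
      using arc_iff[of u v] by metis
    then show False
      using A disjointD[OF part(2), of A B] disjointD[OF part(2), of A C] by blast
  qed
  have two: "x = u \<or> x = v" if "A \<in> P" "u \<in> A" "v \<in> A" "x \<in> A" "u \<noteq> v" for A u v x
  proof (rule ccontr)
    assume x: "\<not> (x = u \<or> x = v)"
    \<comment> \<open>Finiteness of \<open>A\<close> comes first: an infinite set has
      \<open>card\<close> 0 and would satisfy the size bound.\<close>
    have "A \<subseteq> pverts D"
      using that(1) unfolding part(1)[symmetric] by (rule Union_upper)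
    then have "finite A"
      using fin by (rule finite_subset)
    then have "card {u, v, x} \<le> card A"
      using that by (intro card_mono) auto
    moreover have "card {u, v, x} = 3"
      using x that(5) by (simp add: eq_commute)
    moreover have "card A \<le> 2"
      using assms(2) that(1) by (rule bspec)
    ultimately show False by simp
  qed
  obtain X a b where X: "X \<in> P" "a \<in> X" "b \<in> X" "a \<noteq> b" "(a, b) \<notin> ?C"
    using assms(1) part(1)
    unfolding loose_multipartite_tournament_def competing12_def graph_clique_def by auto
  have ab: "a \<in> pverts D" "b \<in> pverts D"
    using X part by auto
  have arcV: "u \<in> pverts D" "v \<in> pverts D" "u \<noteq> v" if "(u, v) \<in> ?E" for u v
    using that in_arcsD1 in_arcsD2 anti by blast+
  \<comment> \<open>By \<open>two\<close>, \<open>X\<close> consists of \<open>a\<close> and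
    \<open>b\<close> only, so every other vertex is joined to both by an arc in some
    direction.\<close>
  have to_a: "(v, a) \<in> ?E" if "v \<in> pverts D" "v \<noteq> a" "v \<noteq> b" "(a, v) \<notin> ?E" for v
    using same[of X a v] two[of X a b v] X that by blast
  have to_b: "(v, b) \<in> ?E" if "v \<in> pverts D" "v \<noteq> a" "v \<noteq> b" "(b, v) \<notin> ?E" for v
    using same[of X b v] two[of X a b v] X that by blast
  \<comment> \<open>The names \<open>a'\<close>, \<open>b'\<close> let either member of the pair be
    the sink. Nothing is known about the neighbours of \<open>b'\<close> in the clique, and the
    interval lemma leaves them arbitrary.\<close>
  have sink: ?thesis if "{a', b'} = {a, b}" "\<And>v. (a', v) \<notin> ?E" for a' b'
  proof (rule interval_graph_clique_plus_isolated_plus_vertex)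
    show "(u, v) \<in> ?C \<longleftrightarrow> (v, u) \<in> ?C" for u v
      by (rule step_competition_graph_commute)
    show "(a', u) \<notin> ?C" for u
      using that(2) by (simp add: C_iff)
    have "(u, a') \<in> ?E" if "u \<in> pverts D - {a', b'}" for u
      using that \<open>{a', b'} = {a, b}\<close> \<open>\<And>v. (a', v) \<notin> ?E\<close> to_a[of u] to_b[of u]
      by (auto simp: doubleton_eq_iff)
    then show "(u, v) \<in> ?C" if "u \<in> pverts (C\<^sub>1\<^sub>,\<^sub>2 D) - {a', b'}"
      "v \<in> pverts (C\<^sub>1\<^sub>,\<^sub>2 D) - {a', b'}" "u \<noteq> v" for u v
      using that unfolding C_iff by (auto intro!: exI[of _ a'])
  qed
  show ?thesis
  proof (cases "(\<exists>w. (a, w) \<in> ?E) \<and> (\<exists>z. (b, z) \<in> ?E)")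
    case False
    then show ?thesis using sink[of a b] sink[of b a] by blast
  next
    case True
    then obtain w z where wz: "(a, w) \<in> ?E" "(b, z) \<in> ?E" by blast
    have noab: "(a, b) \<notin> ?E" "(b, a) \<notin> ?E"
      using no_arc X by blast+
    \<comment> \<open>If \<open>x = y\<close>, this is a common out-neighbour of \<open>a\<close>
      and \<open>b\<close>. An arc from \<open>x\<close> to \<open>y\<close> makes \<open>y\<close>
      a witness for competition, reached from \<open>a\<close> via \<open>x\<close> and from
      \<open>b\<close> directly; the opposite arc makes \<open>x\<close> one.\<close>
    have free: "x \<noteq> y \<and> (x, y) \<notin> ?E \<and> (y, x) \<notin> ?E" if "(a, x) \<in> ?E" "(b, y) \<in> ?E" for x y
    proof -
      have "x \<noteq> a" "x \<noteq> b" "y \<noteq> a" "y \<noteq> b"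
        using that noab arcV by blast+
      then show ?thesis
        using X(4,5) ab that unfolding C_iff by blast
    qed
    \<comment> \<open>By \<open>free\<close>, both \<open>x\<close> and \<open>w\<close> are
      non-adjacent to \<open>z\<close> and hence lie in its partite set, which has room for only one
      vertex besides \<open>z\<close>.\<close>
    have Na: "x = w" if "(a, x) \<in> ?E" for x
    proof -
      obtain A where A: "A \<in> P" "z \<in> A" using cover arcV(2)[OF wz(2)] by blast
      have "x \<in> A" "w \<in> A"
        using same[OF A] free[OF that wz(2)] free[OF wz] arcV[OF that] arcV[OF wz(1)] by blast+
      then show ?thesis
        using two[OF A(1), of z w x] A free[OF that wz(2)] free[OF wz] by blast
    qed
    have Nb: "y = z" if "(b, y) \<in> ?E" for y
    proof -
      obtain A where A: "A \<in> P" "w \<in> A" using cover arcV(2)[OF wz(1)] by blast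
      have "y \<in> A" "z \<in> A"
        using same[OF A] free[OF wz(1) that] free[OF wz] arcV[OF that] arcV[OF wz(2)] by blast+
      then show ?thesis
        using two[OF A(1), of w z y] A free[OF wz(1) that] free[OF wz] by blast
    qed
    have ne: "w \<noteq> z" "w \<noteq> a" "w \<noteq> b" "z \<noteq> a" "z \<noteq> b"
      using free[OF wz] wz noab arcV by blast+
    \<comment> \<open>These arcs complete the paths \<open>a\<close>, \<open>w\<close>,
      \<open>b\<close> and \<open>b\<close>, \<open>z\<close>, \<open>a\<close>, by which
      \<open>a\<close> and \<open>b\<close> compete with the vertices outside
      \<open>{a, b, w, z}\<close>.\<close>
    have wb: "(w, b) \<in> ?E" and za: "(z, a) \<in> ?E"
      using to_b[of w] to_a[of z] arcV[OF wz(1)] arcV[OF wz(2)] ne Na Nb by blast+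
    show ?thesis
    proof (rule interval_graph_universal_plus_path_subgraph)
      show "(u, v) \<in> ?C \<longleftrightarrow> (v, u) \<in> ?C" for u v
        by (rule step_competition_graph_commute)
      show "distinct [a, z, w, b]" using ne X(4) by auto
      show "(a, b) \<notin> ?C" by (rule X(5))
      \<comment> \<open>Once \<open>w\<close> is deleted, \<open>a\<close> has no outgoing arc left;
        likewise \<open>b\<close> after deletion of \<open>z\<close>.\<close>
      show "(a, w) \<notin> ?C" "(b, z) \<notin> ?C"
        unfolding C_iff using Na Nb by blast+
      fix u v
      assume uv: "u \<in> pverts (C\<^sub>1\<^sub>,\<^sub>2 D) - {a, b, w, z}" "v \<in> pverts (C\<^sub>1\<^sub>,\<^sub>2 D)" "u \<noteq> v"
      then have u: "(u, a) \<in> ?E" "(u, b) \<in> ?E"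
        using to_a[of u] to_b[of u] Na Nb by auto
      \<comment> \<open>If \<open>v\<close> is neither \<open>a\<close> nor \<open>b\<close> and has
        no arc to \<open>b\<close>, then \<open>v\<close> is an out-neighbour of \<open>b\<close>,
        hence \<open>z\<close>. The vertex witnessing competition with \<open>u\<close> is
        \<open>b\<close> in the first and last case and \<open>a\<close> in the other two.\<close>
      consider "v = a" | "v = b" | "v = z" | "(v, b) \<in> ?E"
        using to_b[of v] uv Nb by auto
      then show "(u, v) \<in> ?C"
      proof cases
        case 1
        then show ?thesis
          unfolding C_iff using uv u wz wb X(4) ne by auto
      next
        case 2
        then show ?thesis
          unfolding C_iff using uv u wz za X(4) ne by auto
      next
        case 3
        then show ?thesis
          unfolding C_iff using uv u za ne by auto
      next
        case 4
        then show ?thesis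
          unfolding C_iff using uv u arcV[OF 4] by auto
      qed
    qed
  qed
qed

end
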